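(* Let $\nu>-1$ be real and let $m\ge 1$ be an integer. Then the positive zeros of $J_\nu$ and of $R_{m-1,\nu+1}J_{\nu+m}$ are interlaced in the sense that $$0<j_{\nu,k_1}<\omega_{m,\nu,1}<j_{\nu,k_2}<\omega_{m,\nu,2}<\cdots .$$
   Context: $J_\nu$ denotes the Bessel function of the first kind of order $\nu$, considered for $x>0$, and $\{j_{\nu,k}\}_{k=1}^\infty$ is the sequence of all its positive zeros in increasing order. For a nonnegative integer $n$ and real $\lambda>0$, the Lommel polynomial (a polynomial in $1/x$) is $$R_{n,\lambda}(x)=\sum_{k=0}^{\lfloor n/2\rfloor}(-1)^k\binom{n-k}{k}\frac{\Gamma(\lambda+n-k)}{\Gamma(\lambda+k)}\left(\frac{x}{2}\right)^{2k-n},\qquad x>0.$$ $\mathcal{N}_{m,\nu}=\{j_{\nu,k} : k\ge 1,\ J_{\nu+m}(j_{\nu,k})=0\}$ is the set of positive zeros common to $J_\nu$ and $J_{\nu+m}$ (possibly empty). The sequence $\{j_{\nu,k_\ell}\}_{\ell=1}^\infty$ is the increasing enumeration of $\{j_{\nu,k}\}_{k=1}^\infty\setminus\mathcal{N}_{m,\nu}$. The sequence $\{\omega_{m,\nu,k}\}_{k=1}^\infty$ is the increasing enumeration of the set $\{x>0: J_{\nu+m}(x)=0\}\cup\{x>0: R_{m-1,\nu+1}(x)=0\}$ (a set union, each element listed once; the elements of $\mathcal{N}_{m,\nu}$ are not removed from it). *)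

theory Defs
  imports "HOL-Analysis.Analysis"
begin

definition bessel_J :: "real \<Rightarrow> real \<Rightarrow> real" where
  "bessel_J \<nu> x =
     (\<Sum>k. (-1) ^ k / fact k * rGamma (\<nu> + real k + 1) * (x / 2) powr (2 * real k + \<nu>))"

definition lommel_R :: "nat \<Rightarrow> real \<Rightarrow> real \<Rightarrow> real" where
  "lommel_R n \<mu> x =
     (\<Sum>k=0..n div 2. (-1) ^ k * real ((n - k) choose k)
        * (Gamma (\<mu> + real n - real k) / Gamma (\<mu> + real k))
        * (x / 2) powi (2 * int k - int n))"

(* Sequences are indexed from 1, as in the usual notation for Bessel zeros; their value at 0 is
   irrelevant. An increasing enumeration exists only for infinite sets of a suitable order type,
   and it is then unique on indices >= 1, so the choice below is immaterial there. Where the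
   set has no such enumeration, increasing_enum is meaningless. *)

definition is_increasing_enum :: "(nat \<Rightarrow> real) \<Rightarrow> real set \<Rightarrow> bool" where
  "is_increasing_enum e S \<longleftrightarrow> strict_mono_on {1..} e \<and> e ` {1..} = S"

definition increasing_enum :: "real set \<Rightarrow> nat \<Rightarrow> real" where
  "increasing_enum S = (SOME e. is_increasing_enum e S)"

definition bessel_zeros :: "real \<Rightarrow> real set" where
  "bessel_zeros \<nu> = {x. 0 < x \<and> bessel_J \<nu> x = 0}"

definition bessel_zero :: "real \<Rightarrow> nat \<Rightarrow> real" where
  "bessel_zero \<nu> = increasing_enum (bessel_zeros \<nu>)"

definition common_zeros :: "nat \<Rightarrow> real \<Rightarrow> real set" where
  "common_zeros m \<nu> =
     {bessel_zero \<nu> k | k. 1 \<le> k \<and> bessel_J (\<nu> + real m) (bessel_zero \<nu> k) = 0}"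

definition noncommon_zeros :: "nat \<Rightarrow> real \<Rightarrow> real set" where
  "noncommon_zeros m \<nu> = {bessel_zero \<nu> k | k. 1 \<le> k} - common_zeros m \<nu>"

definition noncommon_zero :: "nat \<Rightarrow> real \<Rightarrow> nat \<Rightarrow> real" where
  "noncommon_zero m \<nu> = increasing_enum (noncommon_zeros m \<nu>)"

definition omega_set :: "nat \<Rightarrow> real \<Rightarrow> real set" where
  "omega_set m \<nu> =
     {x. 0 < x \<and> bessel_J (\<nu> + real m) x = 0} \<union> {x. 0 < x \<and> lommel_R (m - 1) (\<nu> + 1) x = 0}"

definition omega :: "nat \<Rightarrow> real \<Rightarrow> nat \<Rightarrow> real" where
  "omega m \<nu> = increasing_enum (omega_set m \<nu>)"

end

theory Submission
  imports Defs
begin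

text \<open>
  Put \<open>\<psi>\<^sub>k = J\<^bsub>\<nu>+k\<^esub>\<close> and let \<open>\<phi>\<^sub>k\<close> be the solution
  of the recurrence of the \<open>\<psi>\<^sub>k\<close> with \<open>\<phi>\<^sub>0 = 0\<close>, \<open>\<phi>\<^sub>1 = 1\<close>, so that
  \<open>\<phi>\<^sub>m = R\<^bsub>m-1,\<nu>+1\<^esub>\<close>. The Casoratian
  \<open>\<phi>\<^bsub>m+1\<^esub> \<psi>\<^sub>m - \<phi>\<^sub>m \<psi>\<^bsub>m+1\<^esub>\<close> does not depend on \<open>m\<close> and equals
  \<open>\<psi>\<^sub>0\<close>. Hence \<open>F = \<phi>\<^sub>m \<psi>\<^sub>m / \<psi>\<^sub>0\<close> is the diagonal Green's function of
  a Jacobi operator with spectral parameter \<open>1 / x\<close>, and the Wronskian of \<open>\<psi>\<^sub>0\<close> and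
  \<open>\<phi>\<^sub>m \<psi>\<^sub>m\<close> is \<open>\<psi>\<^sub>m\<^sup>2 a + \<phi>\<^sub>m\<^sup>2 w\<close>, where
  \<open>a = \<phi>\<^sub>m' \<phi>\<^bsub>m+1\<^esub> - \<phi>\<^sub>m \<phi>\<^bsub>m+1\<^esub>'\<close> and
  \<open>w = \<psi>\<^sub>m \<psi>\<^bsub>m+1\<^esub>' - \<psi>\<^sub>m' \<psi>\<^bsub>m+1\<^esub>\<close> are positive by the
  Christoffel--Darboux formula. So \<open>F\<close> increases strictly between its poles, the noncommon zeros
  of \<open>\<psi>\<^sub>0\<close>, and its continuous extension vanishes at the common ones.
\<close>

section \<open>Power series of the Bessel function\<close>

definition bessel_coeff :: "real \<Rightarrow> nat \<Rightarrow> real" where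
  "bessel_coeff \<nu> k = (-1) ^ k / fact k * rGamma (\<nu> + real k + 1)"

text \<open>At \<open>t = x^2 / 4\<close> this is \<open>bessel_J \<nu> x\<close> without its factor
  \<open>(x / 2) powr \<nu>\<close>: an entire function of \<open>t\<close>.\<close>

definition bessel_entire :: "real \<Rightarrow> real \<Rightarrow> real" where
  "bessel_entire \<nu> t = (\<Sum>k. bessel_coeff \<nu> k * t ^ k)"

text \<open>Solved for the earlier coefficient because \<open>\<nu> + k + 1\<close> may vanish; the
  functional equation of \<open>rGamma\<close> holds everywhere.\<close>

lemma bessel_coeff_Suc:
  "bessel_coeff \<nu> k = - (real k + 1) * (\<nu> + real k + 1) * bessel_coeff \<nu> (Suc k)"
proof -
  define g where "g = rGamma (\<nu> + real k + 2)"
  have "rGamma (\<nu> + real k + 1) = (\<nu> + real k + 1) * g"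
    using rGamma_plus1[of "\<nu> + real k + 1"] by (simp add: g_def add_ac)
  moreover have "rGamma (\<nu> + real (Suc k) + 1) = g"
    by (simp add: g_def add_ac)
  ultimately show ?thesis
    by (simp add: bessel_coeff_def divide_simps) (simp add: algebra_simps)
qed

lemma summable_bessel_entire: "summable (\<lambda>k. bessel_coeff \<nu> k * t ^ k)"
proof -
  \<comment> \<open>From \<open>N\<close> on, the two factors of the coefficient recursion are at
    least \<open>2 * \<bar>t\<bar>\<close> and 1, whence the ratio 1/2.\<close>
  obtain N :: nat where N: "real N \<ge> 2 * \<bar>t\<bar> + \<bar>\<nu>\<bar> + 1"
    using real_arch_simple by blast
  show ?thesis
  proof (rule summable_ratio_test[where c = "1/2" and N = N])
    fix n assume n: "N \<le> n"
    define c where "c = bessel_coeff \<nu> (Suc n)"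
    have "2 * \<bar>t\<bar> * 1 \<le> (real n + 1) * (\<nu> + real n + 1)"
      using n N by (intro mult_mono) auto
    then have "2 * \<bar>t\<bar> * (\<bar>c\<bar> * \<bar>t\<bar> ^ n) \<le> (real n + 1) * (\<nu> + real n + 1) * (\<bar>c\<bar> * \<bar>t\<bar> ^ n)"
      by (intro mult_right_mono) auto
    moreover have "\<bar>bessel_coeff \<nu> n\<bar> = (real n + 1) * (\<nu> + real n + 1) * \<bar>c\<bar>"
      unfolding bessel_coeff_Suc[of \<nu> n] c_def using n N by (simp add: abs_mult)
    ultimately show "norm (bessel_coeff \<nu> (Suc n) * t ^ Suc n) \<le> 1/2 * norm (bessel_coeff \<nu> n * t ^ n)"
      by (simp add: abs_mult power_abs c_def algebra_simps)
  qed simp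
qed

lemma DERIV_bessel_entire:
  "(bessel_entire \<nu> has_real_derivative - bessel_entire (\<nu> + 1) t) (at t)"
proof -
  have "diffs (bessel_coeff \<nu>) n = - bessel_coeff (\<nu> + 1) n" for n
    by (simp add: diffs_def bessel_coeff_def add_ac divide_simps)
  then have "(\<Sum>n. diffs (bessel_coeff \<nu>) n * t ^ n) = - bessel_entire (\<nu> + 1) t"
    using summable_bessel_entire[of "\<nu> + 1" t]
    by (simp add: bessel_entire_def suminf_minus)
  moreover have "((\<lambda>x. \<Sum>n. bessel_coeff \<nu> n * x ^ n) has_real_derivative
      (\<Sum>n. diffs (bessel_coeff \<nu>) n * t ^ n)) (at t)"
    by (intro termdiffs_strong_converges_everywhere summable_bessel_entire)
  ultimately show ?thesis
    by (simp add: bessel_entire_def[abs_def])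
qed

lemma bessel_entire_recurrence:
  "bessel_entire \<nu> t + t * bessel_entire (\<nu> + 2) t = (\<nu> + 1) * bessel_entire (\<nu> + 1) t"
proof -
  let ?a = "\<lambda>\<mu> k. bessel_coeff \<mu> k * t ^ k"
  have a: "?a \<mu> sums bessel_entire \<mu> t" for \<mu>
    unfolding bessel_entire_def by (rule summable_sums[OF summable_bessel_entire])
  \<comment> \<open>The series of \<open>t * bessel_entire (\<nu> + 2) t\<close> moved up one index,
    to compare equal powers of \<open>t\<close>.\<close>
  define s where "s = (\<lambda>k. case k of 0 \<Rightarrow> 0 | Suc j \<Rightarrow> t * ?a (\<nu> + 2) j)"
  have "(\<lambda>k. s (Suc k)) sums (t * bessel_entire (\<nu> + 2) t)"
    unfolding s_def using sums_mult[OF a] by simp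
  then have "s sums (t * bessel_entire (\<nu> + 2) t)"
    by (subst (asm) sums_Suc_iff) (simp add: s_def)
  then have "(\<lambda>k. ?a \<nu> k + s k) sums (bessel_entire \<nu> t + t * bessel_entire (\<nu> + 2) t)"
    by (intro sums_add a)
  moreover have "?a \<nu> k + s k = (\<nu> + 1) * ?a (\<nu> + 1) k" for k
  proof (cases k)
    case 0
    then show ?thesis
      using rGamma_plus1[of "\<nu> + 1"] by (simp add: s_def bessel_coeff_def add_ac)
  next
    case (Suc j)
    define g where "g = rGamma (\<nu> + real j + 3)"
    have "rGamma (\<nu> + real j + 2) = (\<nu> + real j + 2) * g"
      using rGamma_plus1[of "\<nu> + real j + 2"] by (simp add: g_def add_ac)
    then have "bessel_coeff \<nu> k + bessel_coeff (\<nu> + 2) j = (\<nu> + 1) * bessel_coeff (\<nu> + 1) k"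
      using Suc by (simp add: bessel_coeff_def g_def add_ac divide_simps) (simp add: algebra_simps)
    then have "(bessel_coeff \<nu> k + bessel_coeff (\<nu> + 2) j) * t ^ k
        = (\<nu> + 1) * bessel_coeff (\<nu> + 1) k * t ^ k"
      by simp
    then show ?thesis
      using Suc by (simp add: s_def algebra_simps)
  qed
  ultimately have "(\<lambda>k. (\<nu> + 1) * ?a (\<nu> + 1) k) sums
      (bessel_entire \<nu> t + t * bessel_entire (\<nu> + 2) t)"
    by simp
  with sums_mult[OF a, of "\<nu> + 1" "\<nu> + 1"] show ?thesis
    using sums_unique2 by blast
qed

text \<open>For \<open>0 < t < \<nu> + 1\<close> the series is alternating with decreasing terms.\<close>

lemma bessel_entire_bounds:
  assumes "\<nu> > -1" "0 < t" "t < \<nu> + 1"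
  shows "rGamma (\<nu> + 2) * (\<nu> + 1 - t) \<le> bessel_entire \<nu> t" "bessel_entire \<nu> t \<le> rGamma (\<nu> + 1)"
proof -
  define a where "a = (\<lambda>k. rGamma (\<nu> + real k + 1) / fact k * t ^ k)"
  have eq: "bessel_coeff \<nu> k * t ^ k = (-1) ^ k * a k" for k
    by (simp add: a_def bessel_coeff_def)
  have pos: "rGamma (\<nu> + real k + 1) > 0" for k
    using assms(1) by (simp add: rGamma_inverse_Gamma Gamma_real_pos)
  have nonneg: "0 \<le> a k" for k
    using pos[of k] assms by (simp add: a_def)
  have decr: "a (Suc k) \<le> a k" for k
  proof -
    have rec: "a k = (\<nu> + real k + 1) * (rGamma (\<nu> + real k + 2) / fact k * t ^ k)"
      using rGamma_plus1[of "\<nu> + real k + 1"] by (simp add: a_def add_ac)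
    have "a (Suc k) = t / (real k + 1) * (rGamma (\<nu> + real k + 2) / fact k * t ^ k)"
      by (simp add: a_def add_ac divide_simps)
    moreover have "t / (real k + 1) \<le> \<nu> + real k + 1"
    proof -
      have "t / (real k + 1) \<le> t / 1"
        using assms by (intro divide_left_mono) auto
      then show ?thesis using assms by simp
    qed
    moreover have "0 \<le> rGamma (\<nu> + real k + 2) / fact k * t ^ k"
      using pos[of "Suc k"] assms by (simp add: add_ac)
    ultimately show ?thesis
      unfolding rec by (metis mult_right_mono)
  qed
  have summ: "summable (\<lambda>k. (-1) ^ k * a k)"
    using summable_bessel_entire[of \<nu> t] by (simp add: eq)
  have "summable (\<lambda>k. norm (bessel_coeff \<nu> k * t ^ k))"
    using powser_insidea[OF summable_bessel_entire[of \<nu> "\<bar>t\<bar> + 1"], of t] by simp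
  then have "summable a"
    using assms pos by (simp add: a_def bessel_coeff_def abs_mult less_imp_le)
  then have lim: "a \<longlonglongrightarrow> 0"
    by (rule summable_LIMSEQ_zero)
  have E: "bessel_entire \<nu> t = (\<Sum>k. (-1) ^ k * a k)"
    by (simp add: bessel_entire_def eq)
  \<comment> \<open>The upper bound is the first partial sum, the lower bound the second.\<close>
  show "bessel_entire \<nu> t \<le> rGamma (\<nu> + 1)"
    using summable_Leibniz'(4)[OF lim nonneg decr, of 0]
    by (simp add: E a_def)
  show "rGamma (\<nu> + 2) * (\<nu> + 1 - t) \<le> bessel_entire \<nu> t"
    using summable_Leibniz'(2)[OF lim nonneg decr, of 1] rGamma_plus1[of "\<nu> + 1"]
    by (simp add: E a_def numeral_2_eq_2 algebra_simps)
qed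

section \<open>Derivative, recurrence and positivity near 0 of the Bessel function\<close>

lemma bessel_J_eq:
  assumes "x > 0"
  shows "bessel_J \<nu> x = (x / 2) powr \<nu> * bessel_entire \<nu> (x\<^sup>2 / 4)"
proof -
  have "(x / 2) powr (2 * real k + \<nu>) = (x / 2) powr \<nu> * (x\<^sup>2 / 4) ^ k" for k
  proof -
    have "(x / 2) powr (2 * real k) = (x / 2) ^ (2 * k)"
      using assms powr_realpow[of "x / 2" "2 * k"] by simp
    then show ?thesis
      by (simp add: powr_add power_mult power_divide)
  qed
  then have "bessel_J \<nu> x = (\<Sum>k. (x / 2) powr \<nu> * (bessel_coeff \<nu> k * (x\<^sup>2 / 4) ^ k))"
    by (simp add: bessel_J_def bessel_coeff_def mult_ac)
  also have "\<dots> = (x / 2) powr \<nu> * bessel_entire \<nu> (x\<^sup>2 / 4)"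
    unfolding bessel_entire_def by (intro suminf_mult summable_bessel_entire)
  finally show ?thesis .
qed

lemma DERIV_bessel_J:
  assumes "x > 0"
  shows "(bessel_J \<nu> has_real_derivative \<nu> / x * bessel_J \<nu> x - bessel_J (\<nu> + 1) x) (at x)"
proof -
  have p: "(x / 2) powr (\<nu> - 1) = (x / 2) powr \<nu> / (x / 2)"
      "(x / 2) powr (\<nu> + 1) = (x / 2) powr \<nu> * (x / 2)"
    using assms powr_diff[of "x / 2" \<nu> 1] powr_add[of "x / 2" \<nu> 1] by auto
  have "((\<lambda>x. bessel_entire \<nu> (x\<^sup>2 / 4)) has_real_derivative
      - bessel_entire (\<nu> + 1) (x\<^sup>2 / 4) * (x / 2)) (at x)"
    by (rule DERIV_chain2[OF DERIV_bessel_entire]) (auto intro!: derivative_eq_intros)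
  moreover have "((\<lambda>x. (x / 2) powr \<nu>) has_real_derivative \<nu> * (x / 2) powr (\<nu> - 1) * (1 / 2)) (at x)"
    using assms by (auto intro!: derivative_eq_intros simp: powr_diff)
  ultimately have "((\<lambda>x. (x / 2) powr \<nu> * bessel_entire \<nu> (x\<^sup>2 / 4)) has_real_derivative
      \<nu> * (x / 2) powr (\<nu> - 1) * (1 / 2) * bessel_entire \<nu> (x\<^sup>2 / 4)
      + - bessel_entire (\<nu> + 1) (x\<^sup>2 / 4) * (x / 2) * (x / 2) powr \<nu>) (at x)"
    by (intro DERIV_mult)
  then have "((\<lambda>x. (x / 2) powr \<nu> * bessel_entire \<nu> (x\<^sup>2 / 4)) has_real_derivative
      \<nu> / x * bessel_J \<nu> x - bessel_J (\<nu> + 1) x) (at x)"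
    using assms by (simp add: p bessel_J_eq mult_ac)
  then show ?thesis
    by (rule has_field_derivative_transform_within_open[where S = "{0<..}"])
       (use assms bessel_J_eq in auto)
qed

lemma bessel_J_recurrence:
  assumes "x > 0"
  shows "bessel_J \<nu> x + bessel_J (\<nu> + 2) x = 2 * (\<nu> + 1) / x * bessel_J (\<nu> + 1) x"
proof -
  have p: "(x / 2) powr (\<nu> + 1) = (x / 2) powr \<nu> * (x / 2)"
      "(x / 2) powr (\<nu> + 2) = (x / 2) powr \<nu> * (x\<^sup>2 / 4)"
    using assms powr_add[of "x / 2" \<nu> 1] powr_add[of "x / 2" \<nu> 2]
    by (auto simp: power_divide)
  have "bessel_J \<nu> x + bessel_J (\<nu> + 2) x = (x / 2) powr \<nu> *
      (bessel_entire \<nu> (x\<^sup>2 / 4) + x\<^sup>2 / 4 * bessel_entire (\<nu> + 2) (x\<^sup>2 / 4))"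
    using assms by (simp add: bessel_J_eq p algebra_simps)
  also have "\<dots> = 2 * (\<nu> + 1) / x * bessel_J (\<nu> + 1) x"
    unfolding bessel_entire_recurrence using assms by (simp add: bessel_J_eq p)
  finally show ?thesis .
qed

text \<open>The alternating series bound excludes zeros below \<open>2 * sqrt (\<nu> + 1)\<close>.
  This keeps zeros from accumulating at 0 and fixes signs near 0.\<close>

lemma bessel_J_pos:
  assumes "\<nu> > -1" "x > 0" "x\<^sup>2 / 4 < \<nu> + 1"
  shows "bessel_J \<nu> x > 0"
proof -
  have "0 < rGamma (\<nu> + 2) * (\<nu> + 1 - x\<^sup>2 / 4)"
    using assms by (simp add: rGamma_inverse_Gamma Gamma_real_pos)
  also have "\<dots> \<le> bessel_entire \<nu> (x\<^sup>2 / 4)"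
    using assms by (intro bessel_entire_bounds) auto
  finally show ?thesis
    using assms by (simp add: bessel_J_eq)
qed

section \<open>Wronskian of neighbouring orders\<close>

text \<open>The Wronskian \<open>J\<^bsub>\<nu>\<^esub> J\<^bsub>\<nu>+1\<^esub>' - J\<^bsub>\<nu>\<^esub>' J\<^bsub>\<nu>+1\<^esub>\<close>,
  with the derivatives eliminated. It increases as the order drops, so positivity passes down from large orders.\<close>

definition bessel_W :: "real \<Rightarrow> real \<Rightarrow> real" where
  "bessel_W \<nu> x = (bessel_J \<nu> x)\<^sup>2 + (bessel_J (\<nu> + 1) x)\<^sup>2
     - (2 * \<nu> + 1) / x * bessel_J \<nu> x * bessel_J (\<nu> + 1) x"

text \<open>The recurrence eliminates order \<open>\<nu> + 2\<close>, so that only the pair of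
  orders \<open>\<nu>\<close>, \<open>\<nu> + 1\<close> remains.\<close>

lemma DERIV_bessel_J_Suc:
  assumes "x > 0"
  shows "(bessel_J (\<nu> + 1) has_real_derivative
     bessel_J \<nu> x - (\<nu> + 1) / x * bessel_J (\<nu> + 1) x) (at x)"
proof (rule DERIV_cong[OF DERIV_bessel_J[OF assms]])
  have "bessel_J (\<nu> + 1 + 1) x = 2 * (\<nu> + 1) / x * bessel_J (\<nu> + 1) x - bessel_J \<nu> x"
    using bessel_J_recurrence[OF assms, of \<nu>] by (simp add: add.assoc)
  then show "(\<nu> + 1) / x * bessel_J (\<nu> + 1) x - bessel_J (\<nu> + 1 + 1) x
      = bessel_J \<nu> x - (\<nu> + 1) / x * bessel_J (\<nu> + 1) x"
    by (simp only:)
qed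

lemma bessel_W_step:
  assumes "x > 0"
  shows "bessel_W \<nu> x = bessel_W (\<nu> + 1) x + 2 * (\<nu> + 1) / x\<^sup>2 * (bessel_J (\<nu> + 1) x)\<^sup>2"
proof -
  define a b where "a = bessel_J \<nu> x" and "b = bessel_J (\<nu> + 1) x"
  have c: "bessel_J (\<nu> + 1 + 1) x = 2 * (\<nu> + 1) / x * b - a"
    using bessel_J_recurrence[OF assms, of \<nu>] by (simp add: add.assoc a_def b_def)
  show ?thesis
    unfolding bessel_W_def c a_def[symmetric] b_def[symmetric]
    using assms by (simp add: field_simps power2_eq_square)
qed

text \<open>The recurrence turns \<open>E \<nu> - (\<nu> + 1 / 2) * E (\<nu> + 1)\<close> into
  \<open>E (\<nu> + 1) / 2 - t * E (\<nu> + 2)\<close>. By the series bounds this is at least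
  \<open>g * (\<nu> + 2 - 3 * t) / 2\<close>, which explains the constant 3.\<close>

lemma bessel_W_pos_large:
  assumes "\<nu> > -1" "x > 0" "3 * (x\<^sup>2 / 4) < \<nu>"
  shows "bessel_W \<nu> x > 0"
proof -
  define t where "t = x\<^sup>2 / 4"
  have t: "0 < t" "3 * t < \<nu>"
    using assms by (auto simp: t_def)
  define E where "E = (\<lambda>\<mu>. bessel_entire \<mu> t)"
  have pos: "E (\<nu> + 1) > 0" "E \<nu> > 0"
  proof -
    have "0 < rGamma (\<mu> + 2) * (\<mu> + 1 - t)" if "\<mu> \<ge> \<nu>" for \<mu>
      using that t by (simp add: rGamma_inverse_Gamma Gamma_real_pos)
    then have "0 < E \<mu>" if "\<mu> \<ge> \<nu>" for \<mu>
      using that bessel_entire_bounds(1)[of \<mu> t] t by (fastforce simp: E_def)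
    then show "E (\<nu> + 1) > 0" "E \<nu> > 0" by auto
  qed
  define g where "g = rGamma (\<nu> + 3)"
  have g: "g > 0" using t by (simp add: g_def rGamma_inverse_Gamma Gamma_real_pos)
  have "g * (\<nu> + 2 - t) \<le> E (\<nu> + 1)"
    using bessel_entire_bounds(1)[of "\<nu> + 1" t] t by (simp add: E_def g_def add_ac)
  moreover have "E (\<nu> + 2) \<le> g"
    using bessel_entire_bounds(2)[of "\<nu> + 2" t] t by (simp add: E_def g_def add_ac)
  then have "t * E (\<nu> + 2) \<le> t * g" using t by simp
  moreover have "0 < g * (\<nu> + 2 - 3 * t)" using g t by simp
  ultimately have d: "E (\<nu> + 1) / 2 - t * E (\<nu> + 2) > 0"
    by (simp add: algebra_simps)
  have "E \<nu> = (\<nu> + 1) * E (\<nu> + 1) - t * E (\<nu> + 2)"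
    using bessel_entire_recurrence[of \<nu> t] by (simp add: E_def)
  then have fac: "E \<nu> - (\<nu> + 1 / 2) * E (\<nu> + 1) = E (\<nu> + 1) / 2 - t * E (\<nu> + 2)"
    by (simp add: algebra_simps)
  have J: "bessel_J \<nu> x = (x / 2) powr \<nu> * E \<nu>"
      "bessel_J (\<nu> + 1) x = (x / 2) powr \<nu> * (x / 2) * E (\<nu> + 1)"
    using assms(2) powr_add[of "x / 2" \<nu> 1] by (auto simp: bessel_J_eq E_def t_def)
  have "bessel_W \<nu> x = ((x / 2) powr \<nu>)\<^sup>2 *
      (E \<nu> * (E \<nu> - (\<nu> + 1 / 2) * E (\<nu> + 1)) + t * (E (\<nu> + 1))\<^sup>2)"
    unfolding bessel_W_def J t_def using assms(2) by (simp add: field_simps power2_eq_square)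
  also have "\<dots> > 0"
    unfolding fac using d pos t assms(2) by (intro mult_pos_pos add_pos_pos) auto
  finally show ?thesis .
qed

lemma bessel_W_pos:
  assumes "\<nu> > -1" "x > 0"
  shows "bessel_W \<nu> x > 0"
proof -
  have "bessel_W \<nu> x > 0" if "\<nu> > -1" "3 * (x\<^sup>2 / 4) < \<nu> + real n" for n \<nu>
    using that
  proof (induction n arbitrary: \<nu>)
    case 0
    then show ?case using bessel_W_pos_large assms(2) by simp
  next
    case (Suc n)
    have "bessel_W (\<nu> + 1) x > 0"
      using Suc.prems by (intro Suc.IH) auto
    moreover have "0 \<le> 2 * (\<nu> + 1) / x\<^sup>2 * (bessel_J (\<nu> + 1) x)\<^sup>2"
      using Suc.prems by simp
    ultimately show ?case
      unfolding bessel_W_step[OF assms(2), of \<nu>] by simp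
  qed
  moreover obtain n :: nat where "3 * (x\<^sup>2 / 4) - \<nu> < real n"
    using reals_Archimedean2 by blast
  ultimately show ?thesis
    using assms(1) by (simp add: algebra_simps)
qed

text \<open>A common zero would make the Wronskian vanish. As the derivative at a zero is
  \<open>- bessel_J (\<nu> + 1) x\<close>, positive zeros are simple.\<close>

lemma bessel_J_Suc_nonzero:
  assumes "\<nu> > -1" "x > 0" "bessel_J \<nu> x = 0"
  shows "bessel_J (\<nu> + 1) x \<noteq> 0"
  using bessel_W_pos[OF assms(1,2)] assms(3) by (auto simp: bessel_W_def)

text \<open>The quotient \<open>q = J\<^bsub>\<nu>+1\<^esub> / J\<^bsub>\<nu>\<^esub>\<close> satisfies the Riccati equation
  \<open>q' = 1 + q\<^sup>2 - (2\<nu> + 1) q / x\<close>; far out, \<open>arctan q\<close> would therefore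
  grow without bound if \<open>q\<close> had no poles.\<close>

lemma unbounded_bessel_zeros:
  assumes "\<nu> > -1"
  shows "\<exists>x>X. bessel_J \<nu> x = 0"
proof (rule ccontr)
  assume contra: "\<not> ?thesis"
  \<comment> \<open>For \<open>z > a\<close> the coefficient \<open>(2 * \<nu> + 1) / z\<close> is
    at most 1 in modulus, so the linear Riccati term is at most \<open>\<bar>q z\<bar>\<close>,
    hence at most \<open>(1 + (q z)^2) / 2\<close>.\<close>
  define a where "a = \<bar>X\<bar> + \<bar>2 * \<nu> + 1\<bar> + 1"
  define q where "q = (\<lambda>x. bessel_J (\<nu> + 1) x / bessel_J \<nu> x)"
  have nz: "bessel_J \<nu> x \<noteq> 0" if "x \<ge> a" for x
    using contra that by (force simp: a_def)
  have dq: "(q has_real_derivative 1 + (q x)\<^sup>2 - (2 * \<nu> + 1) / x * q x) (at x)" if "x \<ge> a" for x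
  proof -
    have x: "x > 0" using that by (simp add: a_def)
    show ?thesis
      unfolding q_def
      by (rule derivative_eq_intros DERIV_bessel_J_Suc DERIV_bessel_J x nz that refl)+
         (use x nz[OF that] in \<open>simp add: field_simps power2_eq_square\<close>)
  qed
  \<comment> \<open>The derivative of \<open>arctan q\<close> will be at least 1/2, so length 10
    forces growth 5, more than the width pi < 4 of the range of \<open>arctan\<close>.\<close>
  have "\<exists>z>a. z < a + 10 \<and> arctan (q (a + 10)) - arctan (q a) = (a + 10 - a) *
      (inverse (1 + (q z)\<^sup>2) * (1 + (q z)\<^sup>2 - (2 * \<nu> + 1) / z * q z))"
    by (rule MVT2) (auto intro!: DERIV_chain2[OF DERIV_arctan] dq simp del: times_divide_eq_left)
  then obtain z where z: "z > a" "arctan (q (a + 10)) - arctan (q a) = 10 *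
      (inverse (1 + (q z)\<^sup>2) * (1 + (q z)\<^sup>2 - (2 * \<nu> + 1) / z * q z))"
    by auto
  have "z > 0" "\<bar>2 * \<nu> + 1\<bar> \<le> z"
    using z(1) by (auto simp: a_def)
  then have "\<bar>(2 * \<nu> + 1) / z\<bar> \<le> 1"
    by (simp add: abs_divide)
  then have "\<bar>(2 * \<nu> + 1) / z * q z\<bar> \<le> \<bar>q z\<bar>"
    unfolding abs_mult by (intro mult_left_le_one_le) auto
  then have "(2 * \<nu> + 1) / z * q z \<le> \<bar>q z\<bar>"
    by (rule abs_le_D1)
  moreover have "2 * \<bar>q z\<bar> \<le> 1 + (q z)\<^sup>2"
    using zero_le_power2[of "\<bar>q z\<bar> - 1"] by (simp add: power2_eq_square algebra_simps)
  ultimately have "(1 + (q z)\<^sup>2) / 2 \<le> 1 + (q z)\<^sup>2 - (2 * \<nu> + 1) / z * q z"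
    by argo
  then have "1 / 2 \<le> inverse (1 + (q z)\<^sup>2) * (1 + (q z)\<^sup>2 - (2 * \<nu> + 1) / z * q z)"
    by (simp add: field_simps add_pos_nonneg)
  then have "5 \<le> arctan (q (a + 10)) - arctan (q a)"
    using z(2) by argo
  then show False
    using arctan_bounded[of "q (a + 10)"] arctan_bounded[of "q a"] pi_less_4 by simp
qed


section \<open>Lommel polynomials\<close>

text \<open>The variable is \<open>z = 1 / x\<close> and the index is shifted:
  \<open>lommel_poly \<nu> (Suc n)\<close> is the Lommel polynomial of degree index \<open>n\<close>
  and parameter \<open>\<nu> + 1\<close>.\<close>

fun lommel_poly :: "real \<Rightarrow> nat \<Rightarrow> real poly" where
  "lommel_poly \<nu> 0 = 0"
| "lommel_poly \<nu> (Suc 0) = 1"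
| "lommel_poly \<nu> (Suc (Suc k)) =
     [:0, 2 * (\<nu> + real k + 1):] * lommel_poly \<nu> (Suc k) - lommel_poly \<nu> k"

lemma poly_lommel_poly_Suc_Suc:
  "poly (lommel_poly \<nu> (Suc (Suc k))) z =
     2 * (\<nu> + real k + 1) * z * poly (lommel_poly \<nu> (Suc k)) z - poly (lommel_poly \<nu> k) z"
  by (simp add: algebra_simps)

definition lommel_coeff :: "real \<Rightarrow> nat \<Rightarrow> nat \<Rightarrow> real" where
  "lommel_coeff \<mu> n k = (-1) ^ k * real ((n - k) choose k)
     * (Gamma (\<mu> + real n - real k) / Gamma (\<mu> + real k))"

text \<open>The binomial vanishes for \<open>2 * k > n\<close>; longer ranges let the sums in the
  recurrence be matched termwise.\<close>

lemma lommel_R_eq_sum: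
  assumes "n \<le> M"
  shows "lommel_R n \<mu> x = (\<Sum>k\<le>M. lommel_coeff \<mu> n k * (x / 2) powi (2 * int k - int n))"
  unfolding lommel_R_def lommel_coeff_def
  by (rule sum.mono_neutral_left) (use assms in \<open>auto simp: not_le\<close>)

lemma lommel_coeff_rec_0:
  assumes "\<mu> > 0"
  shows "lommel_coeff \<mu> (n + 2) 0 = (\<mu> + real n + 1) * lommel_coeff \<mu> (n + 1) 0"
  using assms Gamma_plus1[of "\<mu> + real n + 1"]
  by (simp add: lommel_coeff_def nonpos_Ints_def add_ac)

text \<open>By the functional equation of \<open>Gamma\<close> all three terms are multiples of
  \<open>G / H\<close>. What remains follows from the absorption identity
  \<open>(j + 1) * (a + b) = (N + 1) * a\<close>. For \<open>2 * j > n\<close> all binomials are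
  0.\<close>

lemma lommel_coeff_rec_Suc:
  assumes "\<mu> > 0"
  shows "lommel_coeff \<mu> (n + 2) (Suc j) =
    (\<mu> + real n + 1) * lommel_coeff \<mu> (n + 1) (Suc j) - lommel_coeff \<mu> n j"
proof (cases "2 * j \<le> n")
  case True
  define N where "N = n - j"
  define a b G H where "a = real (N choose j)" and "b = real (N choose Suc j)"
    and "G = Gamma (\<mu> + real N)" and "H = Gamma (\<mu> + real j)"
  have n: "n = N + j" and j: "j \<le> N" using True by (auto simp: N_def)
  have nI: "y \<notin> \<int>\<^sub>\<le>\<^sub>0" if "y > 0" for y :: real
    using that by (auto elim!: nonpos_Ints_cases)
  have G1: "Gamma (\<mu> + real N + 1) = (\<mu> + real N) * G"
    using assms by (simp add: G_def Gamma_plus1 nI)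
  have H1: "Gamma (\<mu> + real j + 1) = (\<mu> + real j) * H"
    using assms by (simp add: H_def Gamma_plus1 nI)
  have H: "H > 0" using assms by (simp add: H_def Gamma_real_pos)
  have "real (Suc j) * real (Suc N choose Suc j) = real (Suc N) * real (N choose j)"
    by (metis Suc_times_binomial of_nat_mult)
  then have ab: "(real j + 1) * (a + b) = (real N + 1) * a"
    by (simp add: a_def b_def algebra_simps)
  have e1: "lommel_coeff \<mu> (n + 2) (Suc j) = - ((-1) ^ j) * (a + b) * ((\<mu> + real N) * G / ((\<mu> + real j) * H))"
    using G1 H1 j by (simp add: lommel_coeff_def n a_def b_def Suc_diff_le add_ac)
  have e2: "lommel_coeff \<mu> (n + 1) (Suc j) = - ((-1) ^ j) * b * (G / ((\<mu> + real j) * H))"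
    using H1 by (simp add: lommel_coeff_def n b_def G_def add_ac)
  have e3: "lommel_coeff \<mu> n j = (-1) ^ j * a * (G / H)"
    by (simp add: lommel_coeff_def n a_def G_def H_def)
  have "(a + b) * (\<mu> + real N) = (\<mu> + real n + 1) * b + a * (\<mu> + real j)"
    using ab by (simp add: n algebra_simps)
  then have "(a + b) * ((\<mu> + real N) * G / ((\<mu> + real j) * H))
      = ((\<mu> + real n + 1) * b + a * (\<mu> + real j)) * (G / ((\<mu> + real j) * H))"
    by (metis mult.assoc times_divide_eq_right)
  also have "\<dots> = (\<mu> + real n + 1) * b * (G / ((\<mu> + real j) * H)) + a * (G / H)"
  proof -
    have "\<mu> + real j > 0" using assms by simp
    then show ?thesis using H by (simp add: divide_simps) (simp add: algebra_simps)
  qed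
  finally show ?thesis
    unfolding e1 e2 e3 by (drule_tac arg_cong[where f = "\<lambda>y. - ((-1) ^ j) * y"]) (simp only: algebra_simps)
next
  case False
  then show ?thesis by (simp add: lommel_coeff_def binomial_eq_0)
qed

lemma lommel_R_recurrence:
  assumes "\<mu> > 0" "x > 0"
  shows "lommel_R (n + 2) \<mu> x = 2 * (\<mu> + real n + 1) / x * lommel_R (n + 1) \<mu> x - lommel_R n \<mu> x"
proof -
  define w where "w = x / 2"
  have w: "w > 0" using assms by (simp add: w_def)
  define c where "c = (\<mu> + real n + 1) / w"
  define p where "p = (\<lambda>k n. w powi (2 * int k - int n))"
  have p1: "p k (n + 2) = p k (n + 1) / w" for k
    using w power_int_diff[of w "2 * int k - int (n + 1)" 1] by (simp add: p_def algebra_simps)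
  \<comment> \<open>Term \<open>k + 1\<close> at \<open>n + 2\<close> meets term \<open>k\<close> at
    \<open>n\<close>; term 0 has no such partner and is treated apart.\<close>
  have p2: "p (Suc k) (n + 2) = p k n" for k
    by (simp add: p_def)
  have t0: "lommel_coeff \<mu> (n + 2) 0 * p 0 (n + 2) = c * (lommel_coeff \<mu> (n + 1) 0 * p 0 (n + 1))"
    unfolding p1 lommel_coeff_rec_0[OF assms(1)] by (simp add: c_def)
  have tS: "lommel_coeff \<mu> (n + 2) (Suc j) * p (Suc j) (n + 2) =
      c * (lommel_coeff \<mu> (n + 1) (Suc j) * p (Suc j) (n + 1)) - lommel_coeff \<mu> n j * p j n" for j
  proof -
    have e: "p (Suc j) (n + 1) = w * p j n" using p1[of "Suc j"] p2[of j] w by (simp add: field_simps)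
    show ?thesis
      unfolding p2 e lommel_coeff_rec_Suc[OF assms(1)] using w by (simp add: c_def field_simps)
  qed
  define f where "f = (\<lambda>l k. lommel_coeff \<mu> l k * p k l)"
  have R: "lommel_R l \<mu> x = (\<Sum>k\<le>M. f l k)" if "l \<le> M" for l M
    using lommel_R_eq_sum[OF that] by (simp add: f_def p_def w_def)
  have "lommel_R (n + 2) \<mu> x = f (n + 2) 0 + (\<Sum>k\<le>n + 1. f (n + 2) (Suc k))"
    using R[of "n + 2" "Suc (n + 1)"] unfolding sum.atMost_Suc_shift by simp
  also have "\<dots> = c * f (n + 1) 0 + (\<Sum>k\<le>n + 1. c * f (n + 1) (Suc k) - f n k)"
    unfolding f_def t0 tS ..
  also have "\<dots> = c * (f (n + 1) 0 + (\<Sum>k\<le>n + 1. f (n + 1) (Suc k))) - (\<Sum>k\<le>n + 1. f n k)"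
    by (simp only: sum_subtractf sum_distrib_left distrib_left add_diff_eq)
  also have "f (n + 1) 0 + (\<Sum>k\<le>n + 1. f (n + 1) (Suc k)) = lommel_R (n + 1) \<mu> x"
    using R[of "n + 1" "Suc (n + 1)"] unfolding sum.atMost_Suc_shift by simp
  also have "(\<Sum>k\<le>n + 1. f n k) = lommel_R n \<mu> x"
    by (subst R[of _ "n + 1"]) simp_all
  finally have "lommel_R (n + 2) \<mu> x = c * lommel_R (n + 1) \<mu> x - lommel_R n \<mu> x" .
  then show ?thesis by (simp add: c_def w_def)
qed

text \<open>Both sides satisfy one three-term recurrence; the initial \<open>Gamma\<close> quotients
  are 1 and \<open>\<nu> + 1\<close>.\<close>

lemma lommel_R_eq_poly:
  assumes "\<nu> > -1" "x > 0"
  shows "lommel_R n (\<nu> + 1) x = poly (lommel_poly \<nu> (Suc n)) (1 / x)"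
proof (induction n rule: induct_nat_012)
  case 0
  have "Gamma (\<nu> + 1) > 0" using assms by (simp add: Gamma_real_pos)
  then show ?case by (simp add: lommel_R_def)
next
  case 1
  have "\<nu> + 1 \<notin> \<int>\<^sub>\<le>\<^sub>0" using assms by (auto elim!: nonpos_Ints_cases)
  then have "Gamma (\<nu> + 1 + 1) = (\<nu> + 1) * Gamma (\<nu> + 1)" by (rule Gamma_plus1)
  moreover have "Gamma (\<nu> + 1) > 0" using assms by (simp add: Gamma_real_pos)
  ultimately have "Gamma (\<nu> + 2) / Gamma (\<nu> + 1) = \<nu> + 1" by (simp add: add.assoc)
  then show ?case by (simp add: lommel_R_def power_int_minus add.assoc)
next
  case (ge2 n)
  have "lommel_R (Suc (Suc n)) (\<nu> + 1) x = 2 * (\<nu> + 1 + real n + 1) / x *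
      lommel_R (Suc n) (\<nu> + 1) x - lommel_R n (\<nu> + 1) x"
    using lommel_R_recurrence[of "\<nu> + 1" x n] assms by simp
  then show ?case
    unfolding ge2 poly_lommel_poly_Suc_Suc[of \<nu> "Suc n"] by (simp add: add_ac del: lommel_poly.simps)
qed

text \<open>Both sequences obey the same recurrence, whose last coefficient -1 preserves the
  determinant; the initial values 0 and 1 make it \<open>bessel_J \<nu> x\<close>.\<close>

lemma lommel_bessel_casoratian:
  assumes "x > 0"
  shows "poly (lommel_poly \<nu> (Suc k)) (1 / x) * bessel_J (\<nu> + real k) x
    - poly (lommel_poly \<nu> k) (1 / x) * bessel_J (\<nu> + real k + 1) x = bessel_J \<nu> x"
proof (induction k)
  case 0
  then show ?case by simp
next
  case (Suc k)
  define c where "c = 2 * (\<nu> + real k + 1) / x"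
  have "\<nu> + real (Suc k) + 1 = \<nu> + real k + 2" by simp
  then have J: "bessel_J (\<nu> + real (Suc k) + 1) x = c * bessel_J (\<nu> + real k + 1) x - bessel_J (\<nu> + real k) x"
    using bessel_J_recurrence[OF assms, of "\<nu> + real k"] unfolding c_def by (simp only:)
  have J': "bessel_J (\<nu> + real (Suc k)) x = bessel_J (\<nu> + real k + 1) x"
    by (simp add: add_ac)
  have P: "poly (lommel_poly \<nu> (Suc (Suc k))) (1 / x) =
      c * poly (lommel_poly \<nu> (Suc k)) (1 / x) - poly (lommel_poly \<nu> k) (1 / x)"
    unfolding poly_lommel_poly_Suc_Suc by (simp add: c_def)
  show ?case
    unfolding P J J' Suc.IH[symmetric] by (simp add: algebra_simps)
qed

text \<open>Christoffel-Darboux by induction: each step adds a nonnegative multiple of a square to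
  the initial value \<open>2 * (\<nu> + 1)\<close>.\<close>

lemma lommel_poly_wronskian_pos:
  assumes "\<nu> > -1" "m \<ge> 1"
  shows "poly (lommel_poly \<nu> m) z * poly (pderiv (lommel_poly \<nu> (Suc m))) z
    - poly (pderiv (lommel_poly \<nu> m)) z * poly (lommel_poly \<nu> (Suc m)) z > 0"
  using assms(2)
proof (induction m rule: nat_induct_at_least)
  case base
  then show ?case using assms by (simp add: pderiv_pCons)
next
  case (Suc m)
  define Q where "Q = lommel_poly \<nu>"
  have "poly (Q (Suc m)) z * poly (pderiv (Q (Suc (Suc m)))) z
      - poly (pderiv (Q (Suc m))) z * poly (Q (Suc (Suc m))) z
    = 2 * (\<nu> + real m + 1) * (poly (Q (Suc m)) z)\<^sup>2
      + (poly (Q m) z * poly (pderiv (Q (Suc m))) z - poly (pderiv (Q m)) z * poly (Q (Suc m)) z)"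
    by (simp add: Q_def pderiv_diff pderiv_mult pderiv_pCons pderiv_smult power2_eq_square algebra_simps)
  moreover have "0 \<le> 2 * (\<nu> + real m + 1) * (poly (Q (Suc m)) z)\<^sup>2"
    using assms by simp
  ultimately show ?case
    using Suc.IH by (simp add: Q_def)
qed

text \<open>Every recurrence coefficient is at least 2 here, so the sequence starting with 0, 1
  never decreases.\<close>

lemma lommel_poly_ge_1:
  assumes "(\<nu> + 1) * z \<ge> 1" "z > 0"
  shows "poly (lommel_poly \<nu> (Suc k)) z \<ge> 1"
proof -
  have "0 \<le> poly (lommel_poly \<nu> k) z \<and> poly (lommel_poly \<nu> k) z \<le> poly (lommel_poly \<nu> (Suc k)) z
      \<and> 1 \<le> poly (lommel_poly \<nu> (Suc k)) z"
  proof (induction k)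
    case (Suc k)
    have "0 \<le> real k * z" using assms by simp
    then have "2 \<le> 2 * (\<nu> + real k + 1) * z" using assms by (simp only: algebra_simps)
    then have "2 * poly (lommel_poly \<nu> (Suc k)) z \<le> 2 * (\<nu> + real k + 1) * z * poly (lommel_poly \<nu> (Suc k)) z"
      using Suc by (intro mult_right_mono) auto
    then show ?case using Suc unfolding poly_lommel_poly_Suc_Suc by linarith
  qed simp
  then show ?thesis by simp
qed

lemma finite_lommel_zeros:
  assumes "\<nu> > -1" "m \<ge> 1"
  shows "finite {x :: real. poly (lommel_poly \<nu> m) (1 / x) = 0}"
proof -
  obtain k where k: "m = Suc k" using assms by (cases m) auto
  have "poly (lommel_poly \<nu> m) (1 / (\<nu> + 1)) \<noteq> 0"
    using lommel_poly_ge_1[of \<nu> "1 / (\<nu> + 1)" k] assms k by auto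
  then have "finite {z. poly (lommel_poly \<nu> m) z = 0}"
    by (intro poly_roots_finite) auto
  \<comment> \<open>The map is injective on all reals because \<open>1 / 0 = 0\<close>.\<close>
  then have "finite ((\<lambda>x. 1 / x) -` {z. poly (lommel_poly \<nu> m) z = 0})"
    by (rule finite_vimageI) (auto simp: inj_def)
  then show ?thesis by (simp add: vimage_def)
qed

section \<open>Locally finite zero sets and their enumerations\<close>

text \<open>Infinitely many zeros would accumulate at some \<open>p\<close>, itself a zero.
  Difference quotients along the zeros are 0, against \<open>f' p \<noteq> 0\<close>.\<close>

lemma finite_simple_zeros:
  fixes f f' :: "real \<Rightarrow> real"
  assumes "\<And>x. x \<in> {a..b} \<Longrightarrow> (f has_real_derivative f' x) (at x)"
    and "\<And>x. x \<in> {a..b} \<Longrightarrow> f x = 0 \<Longrightarrow> f' x \<noteq> 0"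
  shows "finite {x \<in> {a..b}. f x = 0}"
proof (rule ccontr)
  let ?Z = "{x \<in> {a..b}. f x = 0}"
  assume "infinite ?Z"
  then obtain p where p: "p \<in> {a..b}" "p islimpt ?Z"
    using compact_Icc[of a b] unfolding compact_eq_Bolzano_Weierstrass by blast
  have "continuous_on {a..b} f"
    using assms(1) DERIV_isCont by (intro continuous_at_imp_continuous_on) blast
  then have "closed ?Z"
    by (rule continuous_closed_preimage_constant) auto
  then have fp: "f p = 0"
    using p(2) closed_limpt by blast
  have "((\<lambda>x. (f x - f p) / (x - p)) \<longlongrightarrow> f' p) (at p)"
    using assms(1)[OF p(1)] by (simp add: has_field_derivative_iff)
  then have "\<forall>\<^sub>F x in at p. (f x - f p) / (x - p) \<noteq> 0"
    by (rule tendsto_imp_eventually_ne) (use assms(2)[OF p(1) fp] in simp)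
  then have "\<forall>\<^sub>F x in at p. x \<notin> ?Z"
    by eventually_elim (auto simp: fp)
  then show False
    using p(2) by (simp add: islimpt_iff_eventually)
qed

lemma finite_bessel_zeros_atMost:
  assumes "\<nu> > -1"
  shows "finite {x. 0 < x \<and> x \<le> b \<and> bessel_J \<nu> x = 0}"
proof (rule finite_subset)
  \<comment> \<open>By \<open>bessel_J_pos\<close> no zero lies below this point, so a compact
    interval away from 0 suffices.\<close>
  let ?a = "sqrt (4 * (\<nu> + 1))"
  show "{x. 0 < x \<and> x \<le> b \<and> bessel_J \<nu> x = 0} \<subseteq> {x \<in> {?a..b}. bessel_J \<nu> x = 0}"
    using bessel_J_pos[OF assms] by (force intro: real_le_lsqrt simp: not_less)
  show "finite {x \<in> {?a..b}. bessel_J \<nu> x = 0}"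
  proof (intro finite_simple_zeros)
    fix x assume "x \<in> {?a..b}"
    then have x: "x > 0" using assms by (auto intro: less_le_trans[of 0 ?a])
    show "(bessel_J \<nu> has_real_derivative \<nu> / x * bessel_J \<nu> x - bessel_J (\<nu> + 1) x) (at x)"
      by (rule DERIV_bessel_J[OF x])
    show "\<nu> / x * bessel_J \<nu> x - bessel_J (\<nu> + 1) x \<noteq> 0" if "bessel_J \<nu> x = 0"
      using bessel_J_Suc_nonzero[OF assms x that] that by simp
  qed
qed

lemma is_increasing_enum_increasing_enum:
  assumes "infinite S" "\<And>b. finite {x \<in> S. x \<le> b}"
  shows "is_increasing_enum (increasing_enum S) S"
proof -
  have least: "\<exists>x\<in>T. \<forall>y\<in>T. x \<le> y" if T: "T \<subseteq> S" "T \<noteq> {}" for T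
  proof -
    obtain t where t: "t \<in> T" using T by blast
    have fin: "finite {x \<in> T. x \<le> t}"
      by (rule finite_subset[OF _ assms(2)[of t]]) (use T in auto)
    have mem: "Min {x \<in> T. x \<le> t} \<in> {x \<in> T. x \<le> t}"
      by (rule Min_in[OF fin]) (use t in auto)
    have "Min {x \<in> T. x \<le> t} \<le> y" if "y \<in> T" for y
      using that mem Min_le[OF fin, of y] by (cases "y \<le> t") auto
    then show ?thesis using mem by blast
  qed
  \<comment> \<open>Dependent choice: start at the least element and always take the next larger
    one. Local finiteness provides the minima.\<close>
  have "\<exists>f. \<forall>n. (f n \<in> S \<and> (n = 0 \<longrightarrow> (\<forall>y\<in>S. f n \<le> y))) \<and>
      (f n < f (Suc n) \<and> (\<forall>z\<in>S. f n < z \<longrightarrow> f (Suc n) \<le> z))"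
  proof (rule dependent_nat_choice)
    show "\<exists>x. x \<in> S \<and> (0 = (0::nat) \<longrightarrow> (\<forall>y\<in>S. x \<le> y))"
      using least[of S] assms(1) by auto
  next
    fix x and n :: nat
    have "{z \<in> S. x < z} \<noteq> {}"
    proof
      assume "{z \<in> S. x < z} = {}"
      then have "S = {z \<in> S. z \<le> x}" by (auto simp: not_less[symmetric])
      then show False using assms by metis
    qed
    then obtain y where "y \<in> {z \<in> S. x < z}" "\<forall>z\<in>{z \<in> S. x < z}. y \<le> z"
      using least[of "{z \<in> S. x < z}"] by blast
    then show "\<exists>y. (y \<in> S \<and> (Suc n = 0 \<longrightarrow> (\<forall>z\<in>S. y \<le> z))) \<and> x < y \<and> (\<forall>z\<in>S. x < z \<longrightarrow> y \<le> z)"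
      by auto
  qed
  then obtain f where f: "\<And>n. f n \<in> S" "\<And>y. y \<in> S \<Longrightarrow> f 0 \<le> y" "\<And>n. f n < f (Suc n)"
      "\<And>n z. z \<in> S \<Longrightarrow> f n < z \<Longrightarrow> f (Suc n) \<le> z"
    by metis
  have mono: "strict_mono f" by (simp add: strict_mono_Suc_iff f(3))
  have onto: "x \<in> range f" if x: "x \<in> S" for x
  proof (rule ccontr)
    assume nx: "x \<notin> range f"
    have le: "f n \<le> x" for n
    proof (induction n)
      case (Suc n)
      then show ?case using f(4)[OF x, of n] nx by (metis order_le_less rangeI)
    qed (rule f(2)[OF x])
    then have "range f \<subseteq> {y \<in> S. y \<le> x}" using f(1) by auto
    then have "finite (range f)" using assms(2) finite_subset by blast
    then show False
      using mono strict_mono_imp_inj_on[of f UNIV] finite_imageD[of f UNIV] by auto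
  qed
  have "is_increasing_enum (\<lambda>n. f (n - 1)) S"
    unfolding is_increasing_enum_def
  proof
    show "strict_mono_on {1..} (\<lambda>n. f (n - 1))"
      using mono by (auto intro!: strict_mono_onI simp: strict_mono_less)
    have "(\<lambda>n. f (n - 1)) ` {1..} = range f"
    proof
      show "range f \<subseteq> (\<lambda>n. f (n - 1)) ` {1..}"
      proof
        fix y assume "y \<in> range f"
        then obtain k where "y = f k" by blast
        then show "y \<in> (\<lambda>n. f (n - 1)) ` {1..}" by (intro image_eqI[of _ _ "Suc k"]) auto
      qed
    qed auto
    then show "(\<lambda>n. f (n - 1)) ` {1..} = S" using f(1) onto by auto
  qed
  then show ?thesis
    unfolding increasing_enum_def by (rule someI[of "\<lambda>e. is_increasing_enum e S"])
qed

text \<open>The element of \<open>B\<close> between \<open>a l\<close> and \<open>a (Suc l)\<close>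
  has index at least \<open>l\<close>, as earlier ones lie below \<open>a l\<close>. The element of
  \<open>A\<close> between \<open>b l\<close> and \<open>b (Suc l)\<close> has index above
  \<open>l\<close>, as \<open>a l < b l\<close>.\<close>

lemma interlacing_enums:
  assumes a: "is_increasing_enum a A" and b: "is_increasing_enum b B"
    and AB: "\<And>x y. x \<in> A \<Longrightarrow> y \<in> A \<Longrightarrow> x < y \<Longrightarrow> \<exists>z\<in>B. x < z \<and> z < y"
    and BA: "\<And>x y. x \<in> B \<Longrightarrow> y \<in> B \<Longrightarrow> x < y \<Longrightarrow> \<exists>z\<in>A. x < z \<and> z < y"
    and first: "\<And>y. y \<in> B \<Longrightarrow> \<exists>z\<in>A. z < y"
    and l: "l \<ge> 1"
  shows "a l < b l \<and> b l < a (Suc l)"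
proof -
  have mono: "e i < e j \<longleftrightarrow> i < j" "e i \<le> e j \<longleftrightarrow> i \<le> j"
    if "is_increasing_enum e S" "i \<ge> 1" "j \<ge> 1" for e S and i j :: nat
    using that strict_mono_on_less[of "{1..}" e i j] strict_mono_on_less_eq[of "{1..}" e i j]
    by (auto simp: is_increasing_enum_def)
  have mem: "e i \<in> S" if "is_increasing_enum e S" "i \<ge> 1" for e S and i :: nat
    using that by (auto simp: is_increasing_enum_def)
  have ex: "\<exists>i\<ge>1. x = e i" if "is_increasing_enum e S" "x \<in> S" for e S and x :: real
    using that by (auto simp: is_increasing_enum_def)
  note monoa = mono[OF a] and monob = mono[OF b]
  have step: "b l < a (Suc l)" if l: "l \<ge> 1" and prev: "\<And>k. 1 \<le> k \<Longrightarrow> k < l \<Longrightarrow> b k < a l" for l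
  proof -
    obtain z where z: "z \<in> B" "a l < z" "z < a (Suc l)"
      using AB[OF mem[OF a l] mem[OF a, of "Suc l"]] monoa(1)[of l "Suc l"] l by auto
    obtain k where k: "k \<ge> 1" "z = b k" using ex[OF b z(1)] by blast
    have "\<not> k < l" using prev[of k] k z by auto
    then have "b l \<le> z" using monob(2)[of l k] k l by simp
    then show ?thesis using z by simp
  qed
  show ?thesis using l
  proof (induction l rule: nat_induct_at_least)
    case base
    obtain z where z: "z \<in> A" "z < b 1" using first[OF mem[OF b, of 1]] by auto
    obtain k where k: "k \<ge> 1" "z = a k" using ex[OF a z(1)] by blast
    then have "a 1 \<le> z" using monoa(2)[of 1 k] by simp
    then show ?case using z step[of 1] by auto
  next
    case (Suc l)
    obtain z where z: "z \<in> A" "b l < z" "z < b (Suc l)"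
      using BA[OF mem[OF b] mem[OF b, of "Suc l"]] monob(1)[of l "Suc l"] Suc by auto
    obtain k where k: "k \<ge> 1" "z = a k" using ex[OF a z(1)] by blast
    have "a l < a k" using k z Suc by simp
    then have "a (Suc l) \<le> z" using monoa(1)[of l k] monoa(2)[of "Suc l" k] k Suc by simp
    moreover have "b k < a (Suc l)" if "1 \<le> k" "k < Suc l" for k
      using monob(2)[of k l] that Suc by simp
    ultimately show ?case using z step[of "Suc l"] by auto
  qed
qed

section \<open>Monotonicity of the quotient through its Wronskian\<close>

text \<open>The Wronskian is the numerator of the derivative. Continuity is asked of the quotient
  itself, so \<open>u\<close> may vanish at the endpoints.\<close>

lemma quotient_less_of_wronskian_pos:
  fixes u v :: "real \<Rightarrow> real"
  assumes "a < b" "continuous_on {a..b} (\<lambda>x. v x / u x)"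
    and "\<And>x. a < x \<Longrightarrow> x < b \<Longrightarrow> (u has_real_derivative u' x) (at x)"
    and "\<And>x. a < x \<Longrightarrow> x < b \<Longrightarrow> (v has_real_derivative v' x) (at x)"
    and "\<And>x. a < x \<Longrightarrow> x < b \<Longrightarrow> u x \<noteq> 0"
    and "\<And>x. a < x \<Longrightarrow> x < b \<Longrightarrow> u x * v' x - u' x * v x > 0"
  shows "v a / u a < v b / u b"
proof (rule DERIV_pos_imp_increasing_open[OF assms(1)])
  fix x assume x: "a < x" "x < b"
  have "((\<lambda>x. v x / u x) has_real_derivative (v' x * u x - v x * u' x) / (u x * u x)) (at x)"
    using assms(3-5)[OF x] by (intro DERIV_divide)
  moreover have "0 < (v' x * u x - v x * u' x) / (u x * u x)"
    using assms(5,6)[OF x] by (intro divide_pos_pos) (auto simp: mult_ac zero_less_mult_iff)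
  ultimately show "\<exists>y. ((\<lambda>x. v x / u x) has_real_derivative y) (at x) \<and> 0 < y"
    by blast
qed (use assms(2) in simp)

text \<open>At a common zero the quotient of the values is \<open>0 / 0 = 0\<close>, which is the value of the
  continuous extension if the numerator has a double zero and the denominator a simple one.\<close>

lemma isCont_quotient_double_zero:
  fixes u v :: "real \<Rightarrow> real"
  assumes "(u has_real_derivative d) (at c)" "(v has_real_derivative 0) (at c)"
    and "u c = 0" "v c = 0" "d \<noteq> 0"
  shows "isCont (\<lambda>x. v x / u x) c"
proof -
  have "((\<lambda>x. (v x / (x - c)) / (u x / (x - c))) \<longlongrightarrow> 0 / d) (at c)"
    using assms by (intro tendsto_divide) (auto simp: has_field_derivative_iff)
  then have "((\<lambda>x. v x / u x) \<longlongrightarrow> 0) (at c)"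
    by (subst (asm) div_0, elim Lim_transform_eventually) (auto simp: eventually_at_filter)
  then show ?thesis
    using assms by (simp add: isCont_def)
qed

text \<open>The Wronskian can vanish only where \<open>\<phi>\<close> and \<open>\<psi>\<close> both
  do; the second alternative records a simple zero of \<open>u\<close> and a multiple zero of the
  product there.\<close>

lemma bessel_lommel_wronskian:
  fixes \<nu> :: real and m :: nat
  defines "u \<equiv> bessel_J \<nu>"
    and "\<phi> \<equiv> \<lambda>x. poly (lommel_poly \<nu> m) (1 / x)"
    and "\<psi> \<equiv> bessel_J (\<nu> + real m)"
  assumes "\<nu> > -1" "m \<ge> 1" and x: "x > 0"
  obtains u' v' where "(u has_real_derivative u') (at x)"
    and "((\<lambda>x. \<phi> x * \<psi> x) has_real_derivative v') (at x)"
    and "u x * v' - u' * (\<phi> x * \<psi> x) > 0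
      \<or> u x = 0 \<and> \<phi> x = 0 \<and> \<psi> x = 0 \<and> u' \<noteq> 0 \<and> v' = 0"
proof -
  define \<mu> where "\<mu> = \<nu> + real m"
  have \<mu>: "\<mu> > -1" using assms by (simp add: \<mu>_def)
  define \<phi>1 where "\<phi>1 = (\<lambda>x. poly (lommel_poly \<nu> (Suc m)) (1 / x))"
  define \<psi>1 where "\<psi>1 = bessel_J (\<mu> + 1)"
  define d where "d = - poly (pderiv (lommel_poly \<nu> m)) (1 / x) / x\<^sup>2"
  define d1 where "d1 = - poly (pderiv (lommel_poly \<nu> (Suc m))) (1 / x) / x\<^sup>2"
  define e where "e = \<mu> / x * \<psi> x - \<psi>1 x"
  define e1 where "e1 = \<psi> x - (\<mu> + 1) / x * \<psi>1 x"
  have dpoly: "((\<lambda>x. poly q (1 / x)) has_real_derivative - poly (pderiv q) (1 / x) / x\<^sup>2) (at x)" for q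
  proof -
    have "((\<lambda>x. 1 / x) has_real_derivative - 1 / x\<^sup>2) (at x)"
      using x by (auto intro!: derivative_eq_intros simp: power2_eq_square)
    from DERIV_chain2[OF poly_DERIV[of q] this] show ?thesis by simp
  qed
  have D: "(\<phi> has_real_derivative d) (at x)" "(\<phi>1 has_real_derivative d1) (at x)"
    unfolding \<phi>_def \<phi>1_def d_def d1_def by (rule dpoly)+
  have E: "(\<psi> has_real_derivative e) (at x)" "(\<psi>1 has_real_derivative e1) (at x)"
    using DERIV_bessel_J[OF x, of \<mu>] DERIV_bessel_J_Suc[OF x, of \<mu>]
    by (simp_all add: \<psi>_def \<psi>1_def e_def e1_def \<mu>_def)
  have cas: "\<phi>1 y * \<psi> y - \<phi> y * \<psi>1 y = u y" if "y > 0" for y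
    using lommel_bessel_casoratian[OF that, of \<nu> m]
    by (simp add: \<phi>_def \<phi>1_def \<psi>_def \<psi>1_def u_def \<mu>_def)
  define u' where "u' = d1 * \<psi> x + e * \<phi>1 x - (d * \<psi>1 x + e1 * \<phi> x)"
  define v' where "v' = d * \<psi> x + e * \<phi> x"
  have "((\<lambda>y. \<phi>1 y * \<psi> y - \<phi> y * \<psi>1 y) has_real_derivative u') (at x)"
    unfolding u'_def by (intro DERIV_diff DERIV_mult D E)
  then have du: "(u has_real_derivative u') (at x)"
    by (rule has_field_derivative_transform_within_open[where S = "{0<..}"]) (use x cas in auto)
  have dv: "((\<lambda>x. \<phi> x * \<psi> x) has_real_derivative v') (at x)"
    unfolding v'_def by (intro DERIV_mult D E)
  define a where "a = d * \<phi>1 x - \<phi> x * d1"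
  define w where "w = \<psi> x * e1 - e * \<psi>1 x"
  \<comment> \<open>The derivative of \<open>1 / x\<close> is negative, which reverses the sign of
    the polynomial Wronskian.\<close>
  have "a = (poly (lommel_poly \<nu> m) (1 / x) * poly (pderiv (lommel_poly \<nu> (Suc m))) (1 / x)
      - poly (pderiv (lommel_poly \<nu> m)) (1 / x) * poly (lommel_poly \<nu> (Suc m)) (1 / x)) / x\<^sup>2"
    unfolding a_def d_def d1_def \<phi>_def \<phi>1_def by (simp add: diff_divide_distrib)
  then have a: "a > 0"
    using lommel_poly_wronskian_pos[OF assms(4,5), of "1 / x"] x by (simp only:) (rule divide_pos_pos, auto)
  have "w = bessel_W \<mu> x"
    using x by (simp add: w_def e_def e1_def bessel_W_def \<psi>_def \<psi>1_def \<mu>_def field_simps power2_eq_square)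
  then have w: "w > 0" using bessel_W_pos[OF \<mu> x] by simp
  have W: "u x * v' - u' * (\<phi> x * \<psi> x) = (\<psi> x)\<^sup>2 * a + (\<phi> x)\<^sup>2 * w"
    unfolding cas[OF x, symmetric] u'_def v'_def a_def w_def
    by (simp add: algebra_simps power2_eq_square)
  show ?thesis
  proof (rule that[OF du dv])
    show "u x * v' - u' * (\<phi> x * \<psi> x) > 0
      \<or> u x = 0 \<and> \<phi> x = 0 \<and> \<psi> x = 0 \<and> u' \<noteq> 0 \<and> v' = 0"
    proof (cases "\<phi> x = 0 \<and> \<psi> x = 0")
      case True
      then have "u x = 0" using cas[OF x] by simp
      moreover have "v' = 0" using True by (simp add: v'_def)
      \<comment> \<open>The same derivative computed a second way, so that simplicity of the zeros
        of \<open>u\<close> applies.\<close>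
      moreover have "u' = \<nu> / x * u x - bessel_J (\<nu> + 1) x"
        using DERIV_bessel_J[OF x] DERIV_unique[OF du] unfolding u_def by blast
      ultimately show ?thesis
        using True bessel_J_Suc_nonzero[OF assms(4) x] by (simp add: u_def)
    next
      case False
      then have "(\<psi> x)\<^sup>2 * a + (\<phi> x)\<^sup>2 * w > 0"
        using a w by (auto intro: add_pos_nonneg add_nonneg_pos)
      then show ?thesis using W by simp
    qed
  qed
qed

lemma infinite_bessel_zeros:
  assumes "\<nu> > -1"
  shows "infinite {x. 0 < x \<and> bessel_J \<nu> x = 0}"
proof
  assume fin: "finite {x. 0 < x \<and> bessel_J \<nu> x = 0}"
  obtain x where "x > Max (insert 0 {x. 0 < x \<and> bessel_J \<nu> x = 0})" "bessel_J \<nu> x = 0"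
    using unbounded_bessel_zeros[OF assms] by blast
  then show False using fin by auto
qed

section \<open>Interlacing of the two zero sets\<close>

theorem theorem3p2:
  fixes \<nu> :: real and m :: nat
  assumes "\<nu> > -1" and "m \<ge> 1"
  shows "is_increasing_enum (bessel_zero \<nu>) (bessel_zeros \<nu>)
    \<and> is_increasing_enum (noncommon_zero m \<nu>) (noncommon_zeros m \<nu>)
    \<and> is_increasing_enum (omega m \<nu>) (omega_set m \<nu>)
    \<and> 0 < noncommon_zero m \<nu> 1
    \<and> (\<forall>l\<ge>1. noncommon_zero m \<nu> l < omega m \<nu> l
           \<and> omega m \<nu> l < noncommon_zero m \<nu> (Suc l))"
proof -
  define u where "u = bessel_J \<nu>"
  define \<phi> where "\<phi> = (\<lambda>x. poly (lommel_poly \<nu> m) (1 / x))"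
  define \<psi> where "\<psi> = bessel_J (\<nu> + real m)"
  define v where "v = (\<lambda>x. \<phi> x * \<psi> x)"
  define A where "A = {x. 0 < x \<and> u x = 0 \<and> \<psi> x \<noteq> 0}"
  define B where "B = {x. 0 < x \<and> v x = 0}"
  have "\<exists>u' v'. (u has_real_derivative u') (at x) \<and> (v has_real_derivative v') (at x) \<and>
      (u x * v' - u' * v x > 0 \<or> u x = 0 \<and> \<phi> x = 0 \<and> \<psi> x = 0 \<and> u' \<noteq> 0 \<and> v' = 0)" if "x > 0" for x
    unfolding u_def v_def \<phi>_def \<psi>_def by (rule bessel_lommel_wronskian[OF assms that]) blast
  then obtain u' v' where du: "\<And>x. x > 0 \<Longrightarrow> (u has_real_derivative u' x) (at x)"
    and dv: "\<And>x. x > 0 \<Longrightarrow> (v has_real_derivative v' x) (at x)"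
    and W: "\<And>x. x > 0 \<Longrightarrow> u x * v' x - u' x * v x > 0
      \<or> u x = 0 \<and> \<phi> x = 0 \<and> \<psi> x = 0 \<and> u' x \<noteq> 0 \<and> v' x = 0"
    by metis
  have v0: "v x = 0" if "\<psi> x = 0" for x
    using that by (simp add: v_def)
  \<comment> \<open>Where \<open>u\<close> and \<open>v\<close> both vanish the Wronskian is 0,
    leaving the second alternative. In particular \<open>A\<close> and \<open>B\<close> are
    disjoint.\<close>
  have common: "\<phi> x = 0 \<and> \<psi> x = 0 \<and> u' x \<noteq> 0 \<and> v' x = 0" if "x > 0" "u x = 0" "v x = 0" for x
    using W[OF that(1)] that by auto

  \<comment> \<open>The common zeros are defined through indices, so \<open>bessel_zero\<close> must
    first be known to reach every zero.\<close>
  have zero_enum: "is_increasing_enum (bessel_zero \<nu>) (bessel_zeros \<nu>)"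
    unfolding bessel_zero_def
  proof (rule is_increasing_enum_increasing_enum)
    show "infinite (bessel_zeros \<nu>)"
      using infinite_bessel_zeros[OF assms(1)] by (simp add: bessel_zeros_def)
    show "finite {x \<in> bessel_zeros \<nu>. x \<le> b}" for b
      by (rule finite_subset[OF _ finite_bessel_zeros_atMost[OF assms(1), of b]])
        (auto simp: bessel_zeros_def)
  qed
  then have zeros: "{bessel_zero \<nu> k | k. 1 \<le> k} = bessel_zeros \<nu>"
    by (force simp: is_increasing_enum_def)
  have "common_zeros m \<nu> = {x \<in> {bessel_zero \<nu> k | k. 1 \<le> k}. \<psi> x = 0}"
    by (auto simp: common_zeros_def \<psi>_def)
  then have noncommon: "noncommon_zeros m \<nu> = A"
    unfolding noncommon_zeros_def zeros by (auto simp: A_def bessel_zeros_def u_def)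
  have omega: "omega_set m \<nu> = B"
    using assms lommel_R_eq_poly[OF assms(1), of _ "m - 1"]
    by (auto simp: omega_set_def B_def v_def \<phi>_def \<psi>_def)

  have fin\<phi>: "finite {x. \<phi> x = 0}"
    unfolding \<phi>_def by (rule finite_lommel_zeros[OF assms])
  have \<mu>: "\<nu> + real m > -1" using assms by simp
  have finA: "finite {x \<in> A. x \<le> b}" for b
    by (rule finite_subset[OF _ finite_bessel_zeros_atMost[OF assms(1), of b]])
      (auto simp: A_def u_def)
  have finB: "finite {x \<in> B. x \<le> b}" for b
    by (rule finite_subset[OF _ finite_UnI[OF fin\<phi> finite_bessel_zeros_atMost[OF \<mu>, of b]]])
      (auto simp: B_def v_def \<psi>_def)
  have infA: "infinite A"
  proof
    assume "finite A"
    \<comment> \<open>A zero of \<open>u\<close> outside \<open>A\<close> is common, hence one of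
      the finitely many zeros of \<open>\<phi>\<close>.\<close>
    moreover have "{x. 0 < x \<and> bessel_J \<nu> x = 0} \<subseteq> A \<union> {x. \<phi> x = 0}"
      using common v0 by (auto simp: A_def u_def)
    ultimately show False
      using infinite_bessel_zeros[OF assms(1)] fin\<phi> by (meson finite_UnI finite_subset)
  qed
  have infB: "infinite B"
  proof (rule infinite_super[OF _ infinite_bessel_zeros[OF \<mu>]])
    show "{x. 0 < x \<and> bessel_J (\<nu> + real m) x = 0} \<subseteq> B"
      using v0 by (auto simp: B_def \<psi>_def)
  qed
  have enumA: "is_increasing_enum (noncommon_zero m \<nu>) A"
    unfolding noncommon_zero_def noncommon
    by (rule is_increasing_enum_increasing_enum[OF infA finA])
  have enumB: "is_increasing_enum (omega m \<nu>) B"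
    unfolding omega_def omega
    by (rule is_increasing_enum_increasing_enum[OF infB finB])

  have cont: "isCont (\<lambda>x. v x / u x) x" if "x > 0" "x \<notin> A" for x
  proof (cases "u x = 0")
    case True
    then have "v x = 0" using that v0 by (auto simp: A_def)
    with common[OF that(1) True] du[OF that(1)] dv[OF that(1)] True show ?thesis
      by (auto intro: isCont_quotient_double_zero)
  next
    case False
    then show ?thesis
      using DERIV_isCont[OF du] DERIV_isCont[OF dv] that by (intro continuous_divide) auto
  qed
  \<comment> \<open>The interior avoids \<open>B\<close>, so \<open>\<psi>\<close> and therefore
    \<open>u\<close> are nonzero there; the endpoints may be common zeros.\<close>
  have incr: "v a / u a < v b / u b"
    if "0 < a" "a < b" "\<And>x. x \<in> {a..b} \<Longrightarrow> x \<notin> A" "\<And>x. a < x \<Longrightarrow> x < b \<Longrightarrow> x \<notin> B" for a b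
  proof (rule quotient_less_of_wronskian_pos[where u' = u' and v' = v'])
    show "continuous_on {a..b} (\<lambda>x. v x / u x)"
      using that cont by (intro continuous_at_imp_continuous_on) auto
    fix x assume x: "a < x" "x < b"
    have nv: "v x \<noteq> 0" using that(1,4) x by (auto simp: B_def)
    then have "\<psi> x \<noteq> 0" using v0 by blast
    then show "u x \<noteq> 0" "u x * v' x - u' x * v x > 0"
      using that(1,3) x W[of x] by (auto simp: A_def)
  qed (use that du dv in auto)

  have AB: "\<exists>z\<in>B. x < z \<and> z < y" if "x \<in> A" "y \<in> A" "x < y" for x y
  proof (rule ccontr)
    assume contra: "\<not> ?thesis"
    have nv: "v z \<noteq> 0" if z: "x \<le> z" "z \<le> y" for z
    proof (cases "z = x \<or> z = y")
      case True
      then show ?thesis using common[of z] \<open>x \<in> A\<close> \<open>y \<in> A\<close> by (auto simp: A_def)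
    next
      case False
      then show ?thesis using contra z \<open>x \<in> A\<close> by (auto simp: A_def B_def less_le)
    qed
    have pos: "z > 0" if "x \<le> z" for z using that \<open>x \<in> A\<close> by (auto simp: A_def)
    \<comment> \<open>\<open>v / u\<close> has poles at both ends, so its negative reciprocal is
      used: it increases too, yet is 0 at both ends.\<close>
    have "- u x / v x < - u y / v y"
    proof (rule quotient_less_of_wronskian_pos[where u' = v' and v' = "\<lambda>z. - u' z"])
      show "continuous_on {x..y} (\<lambda>z. - u z / v z)"
        using pos nv DERIV_isCont[OF du] DERIV_isCont[OF dv]
        by (intro continuous_at_imp_continuous_on ballI continuous_intros) auto
      fix z assume z: "x < z" "z < y"
      show "((\<lambda>z. - u z) has_real_derivative - u' z) (at z)"
        using pos z by (intro DERIV_minus du) auto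
      show "v z * - u' z - v' z * - u z > 0"
        using W[OF pos, of z] nv[of z] z v0[of z] by (auto simp: mult_ac)
    qed (use that pos nv dv in auto)
    then show False using that by (simp add: A_def)
  qed

  have BA: "\<exists>z\<in>A. x < z \<and> z < y" if "x \<in> B" "y \<in> B" "x < y" for x y
  proof (rule ccontr)
    assume contra: "\<not> ?thesis"
    \<comment> \<open>The minimum \<open>b\<close> of \<open>T\<close> is the next point of
      \<open>B\<close> after \<open>x\<close>; \<open>v / u\<close> would increase from
      \<open>x\<close> to \<open>b\<close> although it is 0 at both, possibly as 0 / 0.\<close>
    define T where "T = {z \<in> B. x < z \<and> z \<le> y}"
    have fin: "finite T"
      by (rule finite_subset[OF _ finB[of y]]) (auto simp: T_def)
    define b where "b = Min T"
    have b: "b \<in> T" using that fin unfolding b_def by (intro Min_in) (auto simp: T_def)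
    have disj: "z \<notin> A" if "z \<in> B" for z
      using that common[of z] by (auto simp: A_def B_def)
    have "v x / u x < v b / u b"
    proof (rule incr)
      show "z \<notin> A" if "z \<in> {x..b}" for z
        using contra disj[of x] disj[of y] \<open>x \<in> B\<close> \<open>y \<in> B\<close> that b
        by (cases "z = x \<or> z = y") (auto simp: T_def)
      show "z \<notin> B" if "x < z" "z < b" for z
        using Min_le[OF fin, of z, folded b_def] that b by (auto simp: T_def)
    qed (use b \<open>x \<in> B\<close> in \<open>auto simp: T_def B_def\<close>)
    moreover have "v x = 0" "v b = 0" using b that by (auto simp: T_def B_def)
    ultimately show False by simp
  qed

  have first: "\<exists>z\<in>A. z < y" if "y \<in> B" for y
  proof (rule ccontr)
    assume contra: "\<not> ?thesis"
    define T where "T = {z \<in> B. z \<le> y}"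
    have fin: "finite T" using finB[of y] by (simp add: T_def)
    define b where "b = Min T"
    have b: "b \<in> T" using that fin unfolding b_def by (intro Min_in) (auto simp: T_def)
    then have b0: "b > 0" by (auto simp: T_def B_def)
    \<comment> \<open>A point below the first element \<open>b\<close> of \<open>B\<close>:
      \<open>x \<le> \<nu> + 1\<close> gives \<open>\<phi> x \<ge> 1\<close>, and with
      \<open>x \<le> 1\<close> also \<open>x^2 / 4 < \<nu> + 1\<close>, so \<open>u\<close> and
      \<open>\<psi>\<close> are positive. Then \<open>v / u\<close> would increase from a positive
      value to 0.\<close>
    define x where "x = min (b / 2) (min 1 (\<nu> + 1))"
    have x: "0 < x" "x < b" "x \<le> 1" "x \<le> \<nu> + 1"
      using b0 assms by (auto simp: x_def)
    have "x\<^sup>2 \<le> x" using x by (simp add: power2_eq_square mult_left_le_one_le)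
    then have small: "x\<^sup>2 / 4 < \<nu> + 1" using x by simp
    have "u x > 0" "\<psi> x > 0"
      unfolding u_def \<psi>_def using x small assms by (auto intro!: bessel_J_pos)
    moreover have "\<phi> x \<ge> 1"
      using lommel_poly_ge_1[of \<nu> "1 / x" "m - 1"] x assms by (simp add: \<phi>_def)
    ultimately have "v x / u x > 0" by (simp add: v_def)
    also have "v x / u x < v b / u b"
    proof (rule incr)
      show "z \<notin> A" if "z \<in> {x..b}" for z
        using contra b that common[of y] \<open>y \<in> B\<close>
        by (cases "z = y") (auto simp: T_def A_def B_def)
      show "z \<notin> B" if "x < z" "z < b" for z
        using Min_le[OF fin, of z, folded b_def] that b by (auto simp: T_def)
    qed (use x in auto)
    also have "v b / u b = 0" using b by (simp add: T_def B_def)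
    finally show False by simp
  qed

  have "noncommon_zero m \<nu> 1 \<in> A"
    using enumA by (auto simp: is_increasing_enum_def)
  then have "0 < noncommon_zero m \<nu> 1"
    by (simp add: A_def)
  then show ?thesis
    using zero_enum enumA enumB interlacing_enums[OF enumA enumB AB BA first]
    by (simp add: noncommon omega)
qed

end
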